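(* Let $\mathbf{x}_t$ be an $N$-variate wide-sense stationary process with moving average representation $\mathbf{x}_t=\sum_{h=0}^{\infty}\boldsymbol\Psi_h\boldsymbol\epsilon_{t-h}$, where the $\boldsymbol\Psi_h$ are real $N\times N$ matrices with $\boldsymbol\Psi_0=\boldsymbol I_N$ and $\boldsymbol\epsilon_t$ is white noise with (possibly non-diagonal) covariance matrix $\boldsymbol\Sigma$, and write $\sigma_{kk}=(\boldsymbol\Sigma)_{k,k}>0$. Suppose that $$\sigma_{kk}^{-1}\sum_{h=0}^{\infty}\left|(\boldsymbol\Psi_h\boldsymbol\Sigma)_{j,k}\right|<+\infty\qquad\text{for all } j,k\in\{1,\dots,N\}.$$ Then for all $j,k\in\{1,\dots,N\}$, $$(\boldsymbol\theta_\infty)_{j,k}=\frac{1}{2\pi}\int_{-\pi}^{\pi}\Gamma_j(\omega)\,(\boldsymbol{\mathfrak{f}}(\omega))_{j,k}\,d\omega,$$ where $\boldsymbol\theta_\infty$ is the infinite-horizon generalized forecast error variance decomposition, $\boldsymbol{\mathfrak{f}}$ is the generalized causation spectrum and $\Gamma_j$ is the weighting function.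
   Context: For a matrix $\boldsymbol A$, $(\boldsymbol A)_{j,k}$ is its entry in row $j$ and column $k$, and $\boldsymbol A'$ is its transpose. Generalized variance decomposition: for a horizon $H$, $$(\boldsymbol\theta_H)_{j,k}=\frac{\sigma_{kk}^{-1}\sum_{h=0}^{H}\left((\boldsymbol\Psi_h\boldsymbol\Sigma)_{j,k}\right)^2}{\sum_{h=0}^{H}(\boldsymbol\Psi_h\boldsymbol\Sigma\boldsymbol\Psi_h')_{j,j}},$$ and $\boldsymbol\theta_\infty$ is the same expression with both sums taken over all $h\ge 0$ (the limit $H\to\infty$). Frequency response function: $\boldsymbol\Psi(e^{-i\omega})=\sum_{h=0}^{\infty}e^{-i\omega h}\boldsymbol\Psi_h$ with $i=\sqrt{-1}$. $\boldsymbol\Psi'(e^{+i\omega})=\sum_{h=0}^{\infty}e^{i\omega h}\boldsymbol\Psi_h'$ is the transpose of $\boldsymbol\Psi(e^{+i\omega})$, i.e. the conjugate transpose of $\boldsymbol\Psi(e^{-i\omega})$. Generalized causation spectrum, for $\omega\in(-\pi,\pi)$: $$(\boldsymbol{\mathfrak{f}}(\omega))_{j,k}=\frac{\sigma_{kk}^{-1}\left|\left(\boldsymbol\Psi(e^{-i\omega})\boldsymbol\Sigma\right)_{j,k}\right|^2}{\left(\boldsymbol\Psi(e^{-i\omega})\boldsymbol\Sigma\boldsymbol\Psi'(e^{+i\omega})\right)_{j,j}},$$ set to $0$ at any $\omega$ where the denominator vanishes. Weighting function: $$\Gamma_j(\omega)=\frac{\left(\boldsymbol\Psi(e^{-i\omega})\boldsymbol\Sigma\boldsymbol\Psi'(e^{+i\omega})\right)_{j,j}}{\frac{1}{2\pi}\int_{-\pi}^{\pi}\left(\boldsymbol\Psi(e^{-i\lambda})\boldsymbol\Sigma\boldsymbol\Psi'(e^{+i\lambda})\right)_{j,j}\,d\lambda}.$$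 In the source setting the moving average representation is obtained by inverting a stable vector autoregression $\boldsymbol\Phi(L)\mathbf{x}_t=\boldsymbol\epsilon_t$, $\boldsymbol\Phi(L)=\boldsymbol I_N-\boldsymbol\Phi_1L-\dots-\boldsymbol\Phi_pL^p$, with the roots of $\det\boldsymbol\Phi(z)$ outside the unit circle, so that $\boldsymbol\Psi_0=\boldsymbol I_N$. *)

theory Defs
  imports "HOL-Probability.Probability"
begin

definition cross_cov :: "'a measure \<Rightarrow> ('a \<Rightarrow> real ^ 'n) \<Rightarrow> ('a \<Rightarrow> real ^ 'n) \<Rightarrow> real ^ 'n ^ 'n" where
  "cross_cov M X Y = (\<chi> j k. LINT w|M.
     (X w $ j - (LINT v|M. X v $ j)) * (Y w $ k - (LINT v|M. Y v $ k)))"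

definition second_order :: "'a measure \<Rightarrow> ('a \<Rightarrow> real ^ 'n) \<Rightarrow> bool" where
  "second_order M X \<longleftrightarrow> X \<in> borel_measurable M \<and> integrable M (\<lambda>w. (norm (X w))\<^sup>2)"

definition white_noise :: "'a measure \<Rightarrow> (int \<Rightarrow> 'a \<Rightarrow> real ^ 'n) \<Rightarrow> real ^ 'n ^ 'n \<Rightarrow> bool" where
  "white_noise M \<epsilon> S \<longleftrightarrow>
     (\<forall>t. second_order M (\<epsilon> t)) \<and>
     (\<forall>t j. (LINT w|M. \<epsilon> t w $ j) = 0) \<and>
     (\<forall>s t. cross_cov M (\<epsilon> s) (\<epsilon> t) = (if s = t then S else 0))"

definition wide_sense_stationary :: "'a measure \<Rightarrow> (int \<Rightarrow> 'a \<Rightarrow> real ^ 'n) \<Rightarrow> bool" where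
  "wide_sense_stationary M x \<longleftrightarrow>
     (\<forall>t. second_order M (x t)) \<and>
     (\<forall>s t j. (LINT w|M. x s w $ j) = (LINT w|M. x t w $ j)) \<and>
     (\<forall>s t h. cross_cov M (x (s + h)) (x s) = cross_cov M (x (t + h)) (x t))"

(* The series x_t = sum_h Psi_h eps_(t-h) converges in mean square. *)
definition ma_representation ::
    "'a measure \<Rightarrow> (int \<Rightarrow> 'a \<Rightarrow> real ^ 'n) \<Rightarrow> (nat \<Rightarrow> real ^ 'n ^ 'n) \<Rightarrow> (int \<Rightarrow> 'a \<Rightarrow> real ^ 'n) \<Rightarrow> bool" where
  "ma_representation M x \<Psi> \<epsilon> \<longleftrightarrow>
     (\<forall>t. (\<lambda>H. LINT w|M. (norm (x t w - (\<Sum>h\<le>H. \<Psi> h *v \<epsilon> (t - int h) w)))\<^sup>2) \<longlonglongrightarrow> 0)"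

definition theta_inf :: "(nat \<Rightarrow> real ^ 'n ^ 'n) \<Rightarrow> real ^ 'n ^ 'n \<Rightarrow> real ^ 'n ^ 'n" where
  "theta_inf \<Psi> S = (\<chi> j k.
     inverse (S $ k $ k) * (\<Sum>h. ((\<Psi> h ** S) $ j $ k)\<^sup>2)
       / (\<Sum>h. (\<Psi> h ** S ** transpose (\<Psi> h)) $ j $ j))"

definition cmat :: "real ^ 'n ^ 'm \<Rightarrow> complex ^ 'n ^ 'm" where
  "cmat A = map_matrix complex_of_real A"

definition ma_term :: "(nat \<Rightarrow> real ^ 'n ^ 'n) \<Rightarrow> complex \<Rightarrow> nat \<Rightarrow> complex ^ 'n ^ 'n" where
  "ma_term \<Psi> z h = map_matrix (\<lambda>a. z ^ h * complex_of_real a) (\<Psi> h)"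

(* Psi(z) = sum_h z^h Psi_h; the frequency response function is Psi(exp (-i omega)). *)
definition ma_transfer :: "(nat \<Rightarrow> real ^ 'n ^ 'n) \<Rightarrow> complex \<Rightarrow> complex ^ 'n ^ 'n" where
  "ma_transfer \<Psi> z = (\<Sum>h. ma_term \<Psi> z h)"

(* The product below has a real diagonal when S is symmetric, see
   spectral_power_of_real, so that taking the real part only changes the type. *)
definition spectral_power ::
    "(nat \<Rightarrow> real ^ 'n ^ 'n) \<Rightarrow> real ^ 'n ^ 'n \<Rightarrow> 'n \<Rightarrow> real \<Rightarrow> real" where
  "spectral_power \<Psi> S j \<omega> =
     Re ((ma_transfer \<Psi> (exp (- (\<i> * of_real \<omega>))) ** cmat S
           ** transpose (ma_transfer \<Psi> (exp (\<i> * of_real \<omega>)))) $ j $ j)"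

(* Where the denominator vanishes the value is 0, by the convention a / 0 = 0. *)
definition causation_spectrum ::
    "(nat \<Rightarrow> real ^ 'n ^ 'n) \<Rightarrow> real ^ 'n ^ 'n \<Rightarrow> real \<Rightarrow> real ^ 'n ^ 'n" where
  "causation_spectrum \<Psi> S \<omega> = (\<chi> j k.
     inverse (S $ k $ k) * (cmod ((ma_transfer \<Psi> (exp (- (\<i> * of_real \<omega>))) ** cmat S) $ j $ k))\<^sup>2
       / spectral_power \<Psi> S j \<omega>)"

definition weighting ::
    "(nat \<Rightarrow> real ^ 'n ^ 'n) \<Rightarrow> real ^ 'n ^ 'n \<Rightarrow> 'n \<Rightarrow> real \<Rightarrow> real" where
  "weighting \<Psi> S j \<omega> =
     spectral_power \<Psi> S j \<omega> / (1 / (2 * pi) * (LBINT l=-pi..pi. spectral_power \<Psi> S j l))"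

lemma ma_term_nth: "ma_term \<Psi> z h $ j $ k = z ^ h * complex_of_real (\<Psi> h $ j $ k)"
  by (simp add: ma_term_def)

lemma summable_vec_iff:
  fixes f :: "nat \<Rightarrow> 'b :: real_normed_vector ^ 'n"
  shows "summable f \<longleftrightarrow> (\<forall>i. summable (\<lambda>h. f h $ i))"
proof
  assume "summable f"
  then show "\<forall>i. summable (\<lambda>h. f h $ i)"
    by (auto intro: bounded_linear.summable[OF bounded_linear_vec_nth])
next
  assume *: "\<forall>i. summable (\<lambda>h. f h $ i)"
  have "(\<lambda>H. \<Sum>h<H. f h) \<longlonglongrightarrow> (\<chi> i. \<Sum>h. f h $ i)"
    by (rule vec_tendstoI) (use * summable_LIMSEQ in auto)
  then show "summable f"
    unfolding summable_def sums_def by blast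
qed

lemma suminf_vec_nth:
  fixes f :: "nat \<Rightarrow> 'b :: real_normed_vector ^ 'n"
  shows "summable f \<Longrightarrow> suminf f $ i = (\<Sum>h. f h $ i)"
  using bounded_linear.suminf[OF bounded_linear_vec_nth, of f i] by simp

lemma ma_transfer_cnj:
  assumes "summable (ma_term \<Psi> z)"
  shows "ma_transfer \<Psi> (cnj z) $ j $ k = cnj (ma_transfer \<Psi> z $ j $ k)"
proof -
  have e: "ma_term \<Psi> (cnj z) h $ j $ k = cnj (ma_term \<Psi> z h $ j $ k)" for h j k
    by (simp add: ma_term_nth)
  have s: "summable (\<lambda>h. ma_term \<Psi> z h $ j $ k)" for j k
    using assms summable_vec_iff by metis
  have "summable (\<lambda>h. ma_term \<Psi> (cnj z) h $ j $ k)" for j k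
    unfolding e using s sums_cnj by (metis summable_def)
  then have s': "summable (ma_term \<Psi> (cnj z))"
    by (simp add: summable_vec_iff)
  have nth: "ma_transfer \<Psi> y $ j $ k = (\<Sum>h. ma_term \<Psi> y h $ j $ k)"
    if "summable (ma_term \<Psi> y)" for y
    using that summable_vec_iff[of "ma_term \<Psi> y"] by (simp add: ma_transfer_def suminf_vec_nth)
  have "(\<lambda>h. cnj (ma_term \<Psi> z h $ j $ k)) sums cnj (\<Sum>h. ma_term \<Psi> z h $ j $ k)"
    using s by (simp add: sums_cnj summable_sums)
  then show ?thesis
    unfolding nth[OF s'] nth[OF assms] e by (simp add: sums_iff)
qed

lemma spectral_power_of_real:
  assumes sym: "transpose S = S"
    and conv: "summable (ma_term \<Psi> (exp (- (\<i> * of_real \<omega>))))"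
  shows "complex_of_real (spectral_power \<Psi> S j \<omega>) =
    (ma_transfer \<Psi> (exp (- (\<i> * of_real \<omega>))) ** cmat S
      ** transpose (ma_transfer \<Psi> (exp (\<i> * of_real \<omega>)))) $ j $ j"
proof -
  define P where "P = ma_transfer \<Psi> (exp (- (\<i> * of_real \<omega>)))"
  have "exp (\<i> * of_real \<omega>) = cnj (exp (- (\<i> * of_real \<omega>)))"
    by (simp add: exp_cnj)
  then have Q: "ma_transfer \<Psi> (exp (\<i> * of_real \<omega>)) $ a $ b = cnj (P $ a $ b)" for a b
    using ma_transfer_cnj[OF conv] by (simp add: P_def)
  have S: "S $ a $ b = S $ b $ a" for a b
    using sym by (metis transpose_def vec_lambda_beta)
  let ?D = "(P ** cmat S ** transpose (ma_transfer \<Psi> (exp (\<i> * of_real \<omega>)))) $ j $ j"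
  have D: "?D = (\<Sum>b\<in>UNIV. \<Sum>a\<in>UNIV. P $ j $ a * of_real (S $ a $ b) * cnj (P $ j $ b))"
    by (simp add: matrix_matrix_mult_def transpose_def Q cmat_def sum_distrib_right)
  have "cnj ?D = (\<Sum>b\<in>UNIV. \<Sum>a\<in>UNIV. P $ j $ b * of_real (S $ b $ a) * cnj (P $ j $ a))"
    unfolding D by (simp add: S mult_ac)
  also have "\<dots> = ?D"
    unfolding D by (rule sum.swap)
  finally have "Im ?D = 0"
    by (metis Reals_cnj_iff complex_is_Real_iff)
  then show ?thesis
    unfolding spectral_power_def P_def by (simp add: complex_eq_iff)
qed

(* Absolute summability of the entries of Psi_h S carries over to Psi_h if S is
   invertible; the frequency response then exists at every frequency. *)
lemma summable_ma_term_invertible: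
  assumes "\<And>j k. summable (\<lambda>h. \<bar>(\<Psi> h ** S) $ j $ k\<bar>)" and "invertible S" and "cmod z = 1"
  shows "summable (ma_term \<Psi> z)"
proof -
  obtain T where T: "S ** T = mat 1"
    using assms(2) unfolding invertible_def by blast
  have *: "summable (\<lambda>h. ma_term \<Psi> z h $ j $ k)" for j k
  proof (rule summable_comparison_test')
    show "summable (\<lambda>h. \<Sum>i\<in>UNIV. \<bar>(\<Psi> h ** S) $ j $ i\<bar> * \<bar>T $ i $ k\<bar>)"
      by (intro summable_sum summable_mult2 assms(1))
    fix h :: nat
    have "\<Psi> h = (\<Psi> h ** S) ** T"
      by (simp add: T matrix_mul_assoc[symmetric])
    then have "\<Psi> h $ j $ k = (\<Sum>i\<in>UNIV. (\<Psi> h ** S) $ j $ i * T $ i $ k)"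
      by (metis (no_types, lifting) matrix_matrix_mult_def vec_lambda_beta sum.cong)
    then have "\<bar>\<Psi> h $ j $ k\<bar> \<le> (\<Sum>i\<in>UNIV. \<bar>(\<Psi> h ** S) $ j $ i * T $ i $ k\<bar>)"
      by (simp add: sum_abs)
    then show "norm (ma_term \<Psi> z h $ j $ k) \<le> (\<Sum>i\<in>UNIV. \<bar>(\<Psi> h ** S) $ j $ i\<bar> * \<bar>T $ i $ k\<bar>)"
      by (simp add: ma_term_nth norm_mult norm_power assms(3) abs_mult)
  qed
  then show ?thesis
    by (simp add: summable_vec_iff)
qed

end

theory Submission
  imports Defs
begin

text \<open>
  The rows of the frequency response enter both sides only through the series of
  \<open>\<Psi>\<^sub>h S\<close>, which converges absolutely, whereas \<open>\<Psi>\<^sub>h\<close> itself need not be summable when \<open>S\<close> is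
  singular. For the spectral power this is seen by choosing \<open>T\<close> with \<open>S T S = S\<close>, so that
  \<open>\<Psi> S \<Psi>\<^sup>* = (\<Psi> S) T (\<Psi> S)\<^sup>*\<close>. Parseval's identity then evaluates numerator and denominator.
  The factor \<open>spectral_power\<close> cancels in the integrand even where it vanishes, because \<open>S\<close> is
  positive semidefinite, so that \<open>p S p\<^sup>* = 0\<close> forces \<open>p S = 0\<close>.
\<close>

section \<open>Parseval's identity for absolutely convergent Fourier series\<close>

text \<open>The frequency response of a single real coefficient sequence. It is written with powers
  of the exponential so that its terms match those of \<open>ma_term\<close>.\<close>

definition fourier_series :: "(nat \<Rightarrow> real) \<Rightarrow> real \<Rightarrow> complex" where
  "fourier_series f \<omega> = (\<Sum>h. exp (- (\<i> * of_real \<omega>)) ^ h * complex_of_real (f h))"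

lemma uniform_limit_fourier_series:
  assumes "summable (\<lambda>h. \<bar>f h\<bar>)"
  shows "uniform_limit A (\<lambda>n \<omega>. \<Sum>h<n. exp (- (\<i> * of_real \<omega>)) ^ h * complex_of_real (f h))
    (fourier_series f) sequentially"
  unfolding fourier_series_def
  by (rule Weierstrass_m_test[where M="\<lambda>h. \<bar>f h\<bar>"]) (simp_all add: norm_mult norm_power assms)

lemma continuous_on_fourier_series [continuous_intros]:
  assumes "summable (\<lambda>h. \<bar>f h\<bar>)"
  shows "continuous_on A (fourier_series f)"
  by (rule uniform_limit_theorem[OF _ uniform_limit_fourier_series[OF assms]])
    (auto intro!: always_eventually continuous_intros)

lemma has_integral_exp_orthogonal:
  "((\<lambda>\<omega>. exp (- (\<i> * of_real \<omega>)) ^ h * cnj (exp (- (\<i> * of_real \<omega>)) ^ l))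
      has_integral (if h = l then 2 * of_real pi else 0)) {-pi..pi}"
proof (cases "h = l")
  case True
  have "exp (- (\<i> * of_real \<omega>)) ^ h * cnj (exp (- (\<i> * of_real \<omega>)) ^ h) = 1" for \<omega> :: real
    by (simp only: complex_norm_square[symmetric]) (simp add: norm_power)
  then show ?thesis
    using has_integral_const_real[of "1::complex" "-pi" pi] True by (simp add: scaleR_conv_of_real)
next
  case False
  define c where "c = \<i> * (of_nat l - of_nat h)"
  have c: "c \<noteq> 0"
    using False by (simp add: c_def)
  have e: "exp (- (\<i> * of_real \<omega>)) ^ h * cnj (exp (- (\<i> * of_real \<omega>)) ^ l) = exp (c * of_real \<omega>)"
    for \<omega> :: real
    by (simp add: c_def exp_cnj exp_of_nat_mult[symmetric] exp_add[symmetric] algebra_simps)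
  have "((\<lambda>\<omega>. exp (c * of_real \<omega>)) has_integral
      exp (c * of_real pi) / c - exp (c * of_real (-pi)) / c) {-pi..pi}"
    by (intro fundamental_theorem_of_calculus
        has_vector_derivative_real_field[where f="\<lambda>z. exp (c * z) / c"])
      (use c in \<open>auto intro!: derivative_eq_intros\<close>)
  \<comment> \<open>The exponents at the two endpoints differ by 2 pi i times the integer l - h, so
    the antiderivative takes the same value there and the integral vanishes.\<close>
  moreover have "exp (c * of_real pi) = exp (c * of_real (-pi))"
  proof -
    have "c * of_real pi = c * of_real (-pi) + of_real (of_int (2 * (int l - int h)) * pi) * \<i>"
      by (simp add: c_def algebra_simps)
    then show ?thesis
      unfolding exp_eq by blast
  qed
  ultimately show ?thesis
    using False by (simp add: e del: complex_cnj_power)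
qed

text \<open>Passes from a gauge integral to the Lebesgue interval integral. Agreement is asked only
  on the open interval because the frequency response is known to converge only there, while the
  continuous function \<open>g\<close> lives on the closed one.\<close>

lemma interval_integral_eq_has_integral:
  fixes f g :: "real \<Rightarrow> real"
  assumes "(g has_integral I) {a..b}" and "continuous_on {a..b} g" and "a \<le> b"
    and "\<And>x. x \<in> {a<..<b} \<Longrightarrow> f x = g x"
  shows "(LBINT x=a..b. f x) = I"
proof -
  have "(LBINT x=a..b. f x) = (LBINT x=a..b. g x)"
    by (rule interval_integral_cong) (use assms(3,4) in \<open>auto simp: min_def max_def einterval_eq\<close>)
  also have "\<dots> = integral {a..b} g"
    by (rule interval_integral_eq_integral[OF assms(3) borel_integrable_atLeastAtMost'[OF assms(2)]])
  finally show ?thesis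
    using assms(1) by (simp add: integral_unique)
qed

text \<open>The sequence \<open>g\<close> tends to 0 and is therefore bounded, so the products are
  dominated by a multiple of |f|.\<close>

lemma summable_mult_abs_summable:
  fixes f g :: "nat \<Rightarrow> real"
  assumes f: "summable (\<lambda>h. \<bar>f h\<bar>)" and g: "summable (\<lambda>h. \<bar>g h\<bar>)"
  shows "summable (\<lambda>h. f h * g h)"
proof -
  have "Bseq (\<lambda>h. \<bar>g h\<bar>)"
    by (rule convergent_imp_Bseq[OF convergentI[OF summable_LIMSEQ_zero[OF g]]])
  then obtain C where "\<And>h. \<bar>g h\<bar> \<le> C"
    by (auto simp: Bseq_def)
  then have "norm (f h * g h) \<le> C * \<bar>f h\<bar>" for h
    by (simp add: abs_mult mult.commute[of C] mult_left_mono)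
  then show ?thesis
    by (rule summable_comparison_test'[OF summable_mult[OF f], of 0])
qed

text \<open>For partial sums the identity is orthogonality of the exponentials. Absolute summability
  makes the partial sums converge uniformly, so the limit passes under the integral.\<close>

lemma parseval:
  assumes f: "summable (\<lambda>h. \<bar>f h\<bar>)" and g: "summable (\<lambda>h. \<bar>g h\<bar>)"
  shows "((\<lambda>\<omega>. Re (fourier_series f \<omega> * cnj (fourier_series g \<omega>))) has_integral
    2 * pi * (\<Sum>h. f h * g h)) {-pi..pi}"
proof -
  let ?e = "\<lambda>\<omega>::real. exp (- (\<i> * of_real \<omega>))"
  let ?P = "\<lambda>f n \<omega>. \<Sum>h<n. ?e \<omega> ^ h * complex_of_real (f h)"
  \<comment> \<open>A product of uniformly convergent sequences converges uniformly once both limits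
    are bounded; here they are continuous on a compact interval.\<close>
  have bdd: "bounded (fourier_series f ` {-pi..pi})" if "summable (\<lambda>h. \<bar>f h\<bar>)" for f
    using that by (intro compact_imp_bounded compact_continuous_image continuous_intros) auto
  have cnj: "uniform_limit {-pi..pi} (\<lambda>n \<omega>. cnj (?P g n \<omega>)) (\<lambda>\<omega>. cnj (fourier_series g \<omega>)) sequentially"
    by (rule bounded_linear.uniform_limit[OF bounded_linear_cnj uniform_limit_fourier_series[OF g]])
  have "bounded ((\<lambda>\<omega>. cnj (fourier_series g \<omega>)) ` {-pi..pi})"
    using bounded_linear_image[OF bdd[OF g] bounded_linear_cnj] by (simp add: image_image)
  from uniform_lim_mult[OF uniform_limit_fourier_series[OF f] cnj bdd[OF f] this]
  have lim: "uniform_limit (cbox (-pi) pi) (\<lambda>n \<omega>. ?P f n \<omega> * cnj (?P g n \<omega>))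
      (\<lambda>\<omega>. fourier_series f \<omega> * cnj (fourier_series g \<omega>)) sequentially"
    by simp
  have I: "((\<lambda>\<omega>. ?P f n \<omega> * cnj (?P g n \<omega>)) has_integral
      of_real (2 * pi * (\<Sum>h<n. f h * g h))) {-pi..pi}" for n
  proof -
    have "((\<lambda>\<omega>. \<Sum>h<n. \<Sum>l<n. (?e \<omega> ^ h * cnj (?e \<omega> ^ l)) * (of_real (f h * g l))) has_integral
        (\<Sum>h<n. \<Sum>l<n. (if h = l then 2 * of_real pi else 0) * of_real (f h * g l))) {-pi..pi}"
      by (intro has_integral_sum has_integral_mult_left has_integral_exp_orthogonal) auto
    moreover have "(\<Sum>h<n. \<Sum>l<n. (?e \<omega> ^ h * cnj (?e \<omega> ^ l)) * (of_real (f h * g l)))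
        = ?P f n \<omega> * cnj (?P g n \<omega>)" for \<omega>
      by (simp add: sum_product mult_ac)
    moreover have "(\<Sum>h<n. \<Sum>l<n. (if h = l then 2 * of_real pi else 0) * of_real (f h * g l))
        = complex_of_real (2 * pi * (\<Sum>h<n. f h * g h))"
      by (simp add: if_distrib[of "\<lambda>c. c * _"] if_distribR sum_distrib_left mult.assoc cong: if_cong)
    ultimately show ?thesis
      by simp
  qed
  obtain I J where
    IJ: "\<And>n. ((\<lambda>\<omega>. ?P f n \<omega> * cnj (?P g n \<omega>)) has_integral I n) (cbox (-pi) pi)"
      "((\<lambda>\<omega>. fourier_series f \<omega> * cnj (fourier_series g \<omega>)) has_integral J) (cbox (-pi) pi)"
      "I \<longlonglongrightarrow> J"
    by (rule uniform_limit_integral_cbox[OF lim]) (auto intro!: continuous_intros)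
  have "I n = of_real (2 * pi * (\<Sum>h<n. f h * g h))" for n
    using has_integral_unique[OF IJ(1)] I by simp
  then have lim1: "(\<lambda>n. 2 * pi * (\<Sum>h<n. f h * g h)) \<longlonglongrightarrow> Re J"
    using tendsto_Re[OF IJ(3)] by simp
  have "summable (\<lambda>h. f h * g h)"
    by (rule summable_mult_abs_summable[OF f g])
  then have "(\<lambda>n. 2 * pi * (\<Sum>h<n. f h * g h)) \<longlonglongrightarrow> 2 * pi * (\<Sum>h. f h * g h)"
    by (intro tendsto_intros summable_LIMSEQ)
  then have "Re J = 2 * pi * (\<Sum>h. f h * g h)"
    by (rule LIMSEQ_unique[OF lim1])
  then show ?thesis
    using has_integral_Re[OF IJ(2)] by simp
qed

section \<open>Covariance matrices\<close>

lemma cross_cov_sym: "transpose (cross_cov M X X) = cross_cov M X X"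
  by (simp add: cross_cov_def transpose_def vec_eq_iff mult.commute)

text \<open>The quadratic form is the variance of the scalar v . X, hence the expectation of a
  square.\<close>

lemma cross_cov_nonneg:
  fixes X :: "'a \<Rightarrow> real ^ 'n"
  assumes "prob_space M" and "second_order M X"
  shows "0 \<le> v \<bullet> (cross_cov M X X *v v)"
proof -
  interpret prob_space M by fact
  define m where "m = (\<chi> j. LINT w|M. X w $ j)"
  define Y where "Y w = X w - m" for w
  have [measurable]: "X \<in> borel_measurable M" and sq: "integrable M (\<lambda>w. (norm (X w))\<^sup>2)"
    using assms(2) by (auto simp: second_order_def)
  have [measurable]: "Y \<in> borel_measurable M"
    unfolding Y_def by measurable
  have [measurable]: "(\<lambda>w. Y w $ j) \<in> borel_measurable M" for j
    by (rule borel_measurable_continuous_on[of "\<lambda>y. y $ j"]) (auto intro!: continuous_intros)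
  \<comment> \<open>Integrability of each product of components lets the finite double sum move
    inside the expectation. The bound comes from (a + b)^2 <= 2 a^2 + 2 b^2, and its constant part
    is integrable because the measure is finite.\<close>
  have int: "integrable M (\<lambda>w. Y w $ j * Y w $ k)" for j k
  proof (rule Bochner_Integration.integrable_bound)
    show "integrable M (\<lambda>w. 2 * (norm (X w))\<^sup>2 + 2 * (norm m)\<^sup>2)"
      using sq by simp
    have "norm (Y w $ j * Y w $ k) \<le> 2 * (norm (X w))\<^sup>2 + 2 * (norm m)\<^sup>2" for w
    proof -
      have "norm (Y w $ j * Y w $ k) \<le> norm (Y w) * norm (Y w)"
        unfolding norm_mult by (intro mult_mono) (auto simp: component_le_norm_cart)
      also have "\<dots> \<le> (norm (X w) + norm m)\<^sup>2"
        unfolding power2_eq_square Y_def by (intro mult_mono norm_triangle_ineq4) auto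
      also have "\<dots> \<le> 2 * (norm (X w))\<^sup>2 + 2 * (norm m)\<^sup>2"
        using sum_squares_bound[of "norm (X w)" "norm m"] by (simp add: power2_sum)
      finally show ?thesis .
    qed
    then show "AE w in M. norm (Y w $ j * Y w $ k) \<le> norm (2 * (norm (X w))\<^sup>2 + 2 * (norm m)\<^sup>2)"
      by (auto intro: order_trans[OF _ abs_ge_self])
  qed measurable
  have "v \<bullet> (cross_cov M X X *v v) = (\<Sum>j\<in>UNIV. \<Sum>k\<in>UNIV. v $ j * v $ k * (LINT w|M. Y w $ j * Y w $ k))"
    by (simp add: inner_vec_def matrix_vector_mult_def cross_cov_def Y_def m_def sum_distrib_left mult_ac)
  also have "\<dots> = (LINT w|M. (\<Sum>j\<in>UNIV. \<Sum>k\<in>UNIV. v $ j * v $ k * (Y w $ j * Y w $ k)))"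
    using int by simp
  also have "\<dots> = (LINT w|M. (v \<bullet> Y w)\<^sup>2)"
    by (simp add: inner_vec_def power2_eq_square sum_product mult_ac)
  finally show ?thesis
    by simp
qed

text \<open>Along u + t w the form is a nonnegative quadratic in t without constant term, so its
  linear coefficient, twice the inner product of S u and w, must vanish for every w.\<close>

lemma psd_isotropic_imp_kernel:
  fixes S :: "real ^ 'n ^ 'n"
  assumes sym: "transpose S = S" and psd: "\<And>v. 0 \<le> v \<bullet> (S *v v)"
    and "u \<bullet> (S *v u) = 0"
  shows "S *v u = 0"
proof -
  have *: "(S *v u) \<bullet> w = 0" for w
  proof (rule ccontr)
    define b where "b = (S *v u) \<bullet> w"
    assume "(S *v u) \<bullet> w \<noteq> 0"
    then have b: "b \<noteq> 0" by (simp add: b_def)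
    define c where "c = w \<bullet> (S *v w)"
    have c: "0 \<le> c" using psd by (simp add: c_def)
    have uw: "u \<bullet> (S *v w) = b"
      using dot_lmul_matrix[of u S w] sym by (metis b_def transpose_matrix_vector)
    have q: "0 \<le> 2 * t * b + t\<^sup>2 * c" for t
      using psd[of "u + t *\<^sub>R w"] assms(3) uw
      by (simp add: matrix_vector_right_distrib matrix_vector_mult_scaleR
          inner_add_left inner_add_right b_def[symmetric] c_def[symmetric] inner_commute[of w "S *v u"]
          power2_eq_square algebra_simps)
    \<comment> \<open>The minimiser would be t = -b / c; the denominator c + 1 also covers c = 0 and
      still gives a negative value.\<close>
    have "0 \<le> 2 * (- b / (c + 1)) * b + (- b / (c + 1))\<^sup>2 * c"
      by (rule q)
    also have "\<dots> = - b\<^sup>2 * (c + 2) / (c + 1)\<^sup>2"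
      using c by (simp add: power2_eq_square divide_simps) (simp add: algebra_simps)
    also have "\<dots> < 0"
      using b c by (simp add: divide_neg_pos)
    finally show False by simp
  qed
  show ?thesis
    using *[of "S *v u"] by simp
qed

text \<open>A linear right inverse of S on its range suffices, since S maps every vector into that
  range; S may be singular.\<close>

lemma generalized_inverse_exists:
  fixes S :: "real ^ 'n ^ 'm"
  obtains T where "S ** T ** S = S"
proof -
  obtain g where g: "linear g" "\<And>v. v \<in> range ((*v) S) \<Longrightarrow> S *v g v = v"
    using linear_exists_right_inverse_on[OF matrix_vector_mul_linear[of S] subspace_UNIV] by blast
  have "S ** matrix g ** S = S"
    using g by (simp add: matrix_eq matrix_vector_mul_assoc[symmetric] matrix_works)
  then show ?thesis by (rule that)
qed

section \<open>The frequency response\<close>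

text \<open>The finite sum of the matrix product is interchanged with the series in h; convergence
  of \<open>ma_term\<close> gives convergence of each entry.\<close>

lemma ma_transfer_times_cmat:
  assumes "summable (ma_term \<Psi> (exp (- (\<i> * of_real \<omega>))))"
  shows "(ma_transfer \<Psi> (exp (- (\<i> * of_real \<omega>))) ** cmat S) $ j $ k
    = fourier_series (\<lambda>h. (\<Psi> h ** S) $ j $ k) \<omega>"
proof -
  let ?z = "exp (- (\<i> * of_real \<omega>))"
  have s: "summable (\<lambda>h. ma_term \<Psi> ?z h $ j)" "summable (\<lambda>h. ma_term \<Psi> ?z h $ j $ a)" for a
    using assms summable_vec_iff by metis+
  have "(ma_transfer \<Psi> ?z ** cmat S) $ j $ k
      = (\<Sum>a\<in>UNIV. (\<Sum>h. ma_term \<Psi> ?z h $ j $ a) * of_real (S $ a $ k))"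
    by (simp add: matrix_matrix_mult_def cmat_def ma_transfer_def suminf_vec_nth assms s)
  also have "\<dots> = (\<Sum>h. \<Sum>a\<in>UNIV. ma_term \<Psi> ?z h $ j $ a * of_real (S $ a $ k))"
    using s by (simp add: suminf_sum suminf_mult2 summable_mult2)
  also have "\<dots> = fourier_series (\<lambda>h. (\<Psi> h ** S) $ j $ k) \<omega>"
    by (simp add: fourier_series_def ma_term_nth matrix_matrix_mult_def sum_distrib_left mult_ac)
  finally show ?thesis .
qed

lemma ma_transfer_exp_cnj:
  assumes "summable (ma_term \<Psi> (exp (- (\<i> * of_real \<omega>))))"
  shows "ma_transfer \<Psi> (exp (\<i> * of_real \<omega>)) $ j $ k
    = cnj (ma_transfer \<Psi> (exp (- (\<i> * of_real \<omega>))) $ j $ k)"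
proof -
  have "exp (\<i> * of_real \<omega>) = cnj (exp (- (\<i> * of_real \<omega>)))"
    by (simp add: exp_cnj)
  then show ?thesis
    using ma_transfer_cnj[OF assms] by simp
qed

text \<open>With the row of the response split as u + i v, the spectral power is the sum of the two
  nonnegative forms of u and v. If it is 0, both vanish, which puts u and v in the kernel of
  S.\<close>

lemma spectral_power_zero_imp:
  assumes sym: "transpose S = S" and psd: "\<And>v. 0 \<le> v \<bullet> (S *v v)"
    and conv: "summable (ma_term \<Psi> (exp (- (\<i> * of_real \<omega>))))"
    and zero: "spectral_power \<Psi> S j \<omega> = 0"
  shows "(ma_transfer \<Psi> (exp (- (\<i> * of_real \<omega>))) ** cmat S) $ j $ k = 0"
proof -
  define p where "p = ma_transfer \<Psi> (exp (- (\<i> * of_real \<omega>))) $ j"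
  define u where "u = (\<chi> a. Re (p $ a))"
  define v where "v = (\<chi> a. Im (p $ a))"
  have S: "S $ a $ b = S $ b $ a" for a b
    using sym by (metis transpose_def vec_lambda_beta)
  have row: "(ma_transfer \<Psi> (exp (- (\<i> * of_real \<omega>))) ** cmat S) $ j $ b
      = Complex ((S *v u) $ b) ((S *v v) $ b)" for b
    by (simp add: matrix_matrix_mult_def matrix_vector_mult_def cmat_def complex_eq_iff
        p_def[symmetric] u_def v_def S[of b] mult.commute)
  \<comment> \<open>The real part of the pairing of S u + i S v with u - i v; the cross terms are
    imaginary.\<close>
  have "spectral_power \<Psi> S j \<omega> = u \<bullet> (S *v u) + v \<bullet> (S *v v)"
    unfolding spectral_power_def matrix_matrix_mult_def[of "_ ** _"]
    by (simp add: row transpose_def ma_transfer_exp_cnj[OF conv] p_def[symmetric] u_def v_def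
        inner_vec_def sum.distrib mult.commute)
  with zero psd[of u] psd[of v] have "u \<bullet> (S *v u) = 0" "v \<bullet> (S *v v) = 0"
    by linarith+
  then have "S *v u = 0" "S *v v = 0"
    by (simp_all add: psd_isotropic_imp_kernel[OF sym psd])
  then show ?thesis
    by (simp add: row complex_eq_iff)
qed

lemma mult_mult_transpose_nth:
  fixes A :: "'a :: comm_semiring_1 ^ 'n ^ 'm"
  shows "(A ** B ** transpose C) $ i $ j = (\<Sum>b\<in>UNIV. \<Sum>a\<in>UNIV. A $ i $ a * B $ a $ b * C $ j $ b)"
  by (simp add: matrix_matrix_mult_def transpose_def sum_distrib_right)

lemma cmat_mult: "cmat (A ** B) = cmat A ** cmat B"
  by (simp add: cmat_def matrix_matrix_mult_def vec_eq_iff)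

lemma transpose_cmat: "transpose (cmat A) = cmat (transpose A)"
  by (simp add: cmat_def transpose_def vec_eq_iff)

text \<open>Exhibits the spectral power as a finite linear combination of Parseval integrands, which
  are continuous on the closed interval even if the response itself diverges at an endpoint.\<close>

lemma spectral_power_eq_fourier:
  assumes sym: "transpose S = S" and T: "S ** T ** S = S"
    and conv: "summable (ma_term \<Psi> (exp (- (\<i> * of_real \<omega>))))"
  shows "spectral_power \<Psi> S j \<omega> = (\<Sum>b\<in>UNIV. \<Sum>a\<in>UNIV. T $ a $ b *
    Re (fourier_series (\<lambda>h. (\<Psi> h ** S) $ j $ a) \<omega> * cnj (fourier_series (\<lambda>h. (\<Psi> h ** S) $ j $ b) \<omega>)))"
proof -
  define P where "P = ma_transfer \<Psi> (exp (- (\<i> * of_real \<omega>)))"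
  define Q where "Q = ma_transfer \<Psi> (exp (\<i> * of_real \<omega>))"
  have PS: "(P ** cmat S) $ j $ b = fourier_series (\<lambda>h. (\<Psi> h ** S) $ j $ b) \<omega>" for b
    unfolding P_def by (rule ma_transfer_times_cmat[OF conv])
  have QS: "(Q ** cmat S) $ j $ b = cnj ((P ** cmat S) $ j $ b)" for b
    by (simp add: matrix_matrix_mult_def cmat_def Q_def P_def ma_transfer_exp_cnj[OF conv])
  have "P ** cmat S ** transpose Q = P ** cmat (S ** T ** S) ** transpose Q"
    by (simp add: T)
  also have "\<dots> = (P ** cmat S) ** cmat T ** transpose (Q ** cmat S)"
    by (simp add: matrix_transpose_mul cmat_mult transpose_cmat sym matrix_mul_assoc)
  finally have "P ** cmat S ** transpose Q = (P ** cmat S) ** cmat T ** transpose (Q ** cmat S)" .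
  then have "spectral_power \<Psi> S j \<omega> = Re (((P ** cmat S) ** cmat T ** transpose (Q ** cmat S)) $ j $ j)"
    by (simp add: spectral_power_def P_def Q_def)
  then show ?thesis
    unfolding mult_mult_transpose_nth QS PS by (simp add: cmat_def algebra_simps)
qed

section \<open>Comparison of the time domain and frequency domain expressions\<close>

theorem proposition2p1:
  fixes M :: "'a measure"
    and x \<epsilon> :: "int \<Rightarrow> 'a \<Rightarrow> real ^ 'n"
    and \<Psi> :: "nat \<Rightarrow> real ^ 'n ^ 'n"
    and S :: "real ^ 'n ^ 'n"
  assumes "prob_space M"
    and "wide_sense_stationary M x"
    and "white_noise M \<epsilon> S"
    and "ma_representation M x \<Psi> \<epsilon>"
    and "\<Psi> 0 = mat 1"
    and "\<And>k. S $ k $ k > 0"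
    and "\<And>\<omega>. \<omega> \<in> {-pi<..<pi} \<Longrightarrow> summable (ma_term \<Psi> (exp (- (\<i> * of_real \<omega>))))"
    and "\<And>j k. summable (\<lambda>h. inverse (S $ k $ k) * \<bar>(\<Psi> h ** S) $ j $ k\<bar>)"
  shows "\<forall>j k. theta_inf \<Psi> S $ j $ k =
    1 / (2 * pi) * (LBINT \<omega>=-pi..pi. weighting \<Psi> S j \<omega> * causation_spectrum \<Psi> S \<omega> $ j $ k)"
proof (intro allI)
  fix j k
  note conv = assms(7)
  have cov: "S = cross_cov M (\<epsilon> 0) (\<epsilon> 0)" and so: "second_order M (\<epsilon> 0)"
    using assms(3) by (auto simp: white_noise_def)
  have sym: "transpose S = S"
    unfolding cov by (rule cross_cov_sym)
  have psd: "0 \<le> v \<bullet> (S *v v)" for v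
    unfolding cov by (rule cross_cov_nonneg[OF assms(1) so])
  obtain T where T: "S ** T ** S = S"
    by (rule generalized_inverse_exists)
  define B where "B = (\<lambda>h. \<Psi> h ** S)"
  have B: "summable (\<lambda>h. \<bar>B h $ j $ k\<bar>)" for j k
    using summable_mult_D[OF assms(8)[of k j]] assms(6)[of k] by (simp add: B_def)
  have BB: "summable (\<lambda>h. B h $ j $ a * B h $ j $ b)" for a b
    by (rule summable_mult_abs_summable[OF B B])
  \<comment> \<open>The time domain counterpart of \<open>spectral_power_eq_fourier\<close>, with
    the same coefficients \<open>T\<close>, so that Parseval matches the two sums term by
    term.\<close>
  have diag: "(\<Psi> h ** S ** transpose (\<Psi> h)) $ j $ j
      = (\<Sum>b\<in>UNIV. \<Sum>a\<in>UNIV. T $ a $ b * (B h $ j $ a * B h $ j $ b))" for h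
  proof -
    have "\<Psi> h ** S ** transpose (\<Psi> h) = \<Psi> h ** (S ** T ** S) ** transpose (\<Psi> h)"
      by (simp add: T)
    also have "\<dots> = B h ** T ** transpose (B h)"
      by (simp add: B_def matrix_transpose_mul sym matrix_mul_assoc)
    finally show ?thesis
      by (simp add: mult_mult_transpose_nth mult_ac)
  qed
  define W where "W = (\<Sum>h. (\<Psi> h ** S ** transpose (\<Psi> h)) $ j $ j)"
  have W_eq: "W = (\<Sum>b\<in>UNIV. \<Sum>a\<in>UNIV. T $ a $ b * (\<Sum>h. B h $ j $ a * B h $ j $ b))"
    unfolding W_def diag by (simp add: suminf_sum summable_sum suminf_mult summable_mult BB)
  let ?F = "\<lambda>a. fourier_series (\<lambda>h. B h $ j $ a)"
  have pars: "((\<lambda>\<omega>. Re (?F a \<omega> * cnj (?F b \<omega>))) has_integral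
      2 * pi * (\<Sum>h. B h $ j $ a * B h $ j $ b)) {-pi..pi}" for a b
    by (rule parseval[OF B B])
  have cont: "continuous_on {-pi..pi} (\<lambda>\<omega>. Re (?F a \<omega> * cnj (?F b \<omega>)))" for a b
    by (intro continuous_intros B)
  \<comment> \<open>Hence the normalising constant of \<open>weighting\<close> is exactly
    \<open>W\<close>, the denominator of \<open>theta_inf\<close>.\<close>
  have power_int: "(LBINT \<omega>=-pi..pi. spectral_power \<Psi> S j \<omega>) = 2 * pi * W"
  proof (rule interval_integral_eq_has_integral)
    show "((\<lambda>\<omega>. \<Sum>b\<in>UNIV. \<Sum>a\<in>UNIV. T $ a $ b * Re (?F a \<omega> * cnj (?F b \<omega>))) has_integral 2 * pi * W) {-pi..pi}"
    proof -
      have "2 * pi * W = (\<Sum>b\<in>UNIV. \<Sum>a\<in>UNIV. T $ a $ b * (2 * pi * (\<Sum>h. B h $ j $ a * B h $ j $ b)))"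
        by (simp add: W_eq sum_distrib_left mult_ac)
      then show ?thesis
        by (simp only:) (intro has_integral_sum has_integral_mult_right pars finite)
    qed
    show "continuous_on {-pi..pi} (\<lambda>\<omega>. \<Sum>b\<in>UNIV. \<Sum>a\<in>UNIV. T $ a $ b * Re (?F a \<omega> * cnj (?F b \<omega>)))"
      by (intro continuous_on_sum continuous_on_mult_left cont)
  qed (use spectral_power_eq_fourier[OF sym T conv] in \<open>simp_all add: B_def\<close>)
  \<comment> \<open>The frequency-independent factor left after the spectral power cancels. It also
    appears in \<open>theta_inf\<close>, so the convention a / 0 = 0 treats both sides alike with
    respect to \<open>W\<close>.\<close>
  let ?c = "inverse (S $ k $ k) / W"
  have "(LBINT \<omega>=-pi..pi. weighting \<Psi> S j \<omega> * causation_spectrum \<Psi> S \<omega> $ j $ k)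
      = ?c * (2 * pi * (\<Sum>h. B h $ j $ k * B h $ j $ k))"
  proof (rule interval_integral_eq_has_integral)
    show "((\<lambda>\<omega>. ?c * Re (?F k \<omega> * cnj (?F k \<omega>))) has_integral
        ?c * (2 * pi * (\<Sum>h. B h $ j $ k * B h $ j $ k))) {-pi..pi}"
      by (rule has_integral_mult_right[OF pars])
    show "continuous_on {-pi..pi} (\<lambda>\<omega>. ?c * Re (?F k \<omega> * cnj (?F k \<omega>)))"
      by (intro continuous_on_mult_left cont)
    show "-pi \<le> pi" by simp
    fix \<omega> assume w: "\<omega> \<in> {-pi<..<pi}"
    let ?G = "(ma_transfer \<Psi> (exp (- (\<i> * of_real \<omega>))) ** cmat S) $ j $ k"
    \<comment> \<open>At a zero of the spectral power the integrand is 0 by convention, so the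
      cancelled form must be shown to vanish there too.\<close>
    have "spectral_power \<Psi> S j \<omega> = 0 \<Longrightarrow> ?G = 0"
      by (rule spectral_power_zero_imp[OF sym psd conv[OF w]])
    then have "weighting \<Psi> S j \<omega> * causation_spectrum \<Psi> S \<omega> $ j $ k = ?c * (cmod ?G)\<^sup>2"
      by (cases "spectral_power \<Psi> S j \<omega> = 0")
        (simp_all add: weighting_def causation_spectrum_def power_int field_simps)
    also have "(cmod ?G)\<^sup>2 = Re (?F k \<omega> * cnj (?F k \<omega>))"
      unfolding ma_transfer_times_cmat[OF conv[OF w]] B_def
      by (simp flip: complex_norm_square)
    finally show "weighting \<Psi> S j \<omega> * causation_spectrum \<Psi> S \<omega> $ j $ k
        = ?c * Re (?F k \<omega> * cnj (?F k \<omega>))" .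
  qed
  then show "theta_inf \<Psi> S $ j $ k =
      1 / (2 * pi) * (LBINT \<omega>=-pi..pi. weighting \<Psi> S j \<omega> * causation_spectrum \<Psi> S \<omega> $ j $ k)"
    by (simp add: theta_inf_def W_def B_def power2_eq_square)
qed

end
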